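(* Let $A\subseteq\omega$ and $0<n^*<\min(A)$. Assume that for each $n\in A$ there is an $\aleph_n$-complete filter $F_n$ on $\aleph_n$ such that $F_n$ contains all cobounded subsets of $\aleph_n$ and the second player has a winning strategy in the game $GM_{\aleph_{n^*}}(F_n)$. Then the set $$S=\{x\subseteq\aleph_\omega : |x|\le\aleph_{n^*},\ \forall n\in A\ [\mathrm{cf}(x\cap\aleph_n)=\aleph_0],\ \text{and } \forall n<\omega\ [n^*<n\notin A\rightarrow \mathrm{cf}(x\cap\aleph_n)=\aleph_{n^*}]\}$$ is stationary in $[\aleph_\omega]^{<\aleph_{n^*+1}}$.
   Context: Let $\kappa>\lambda$ be cardinals and $D$ a filter on $\kappa$; a set $Y\subseteq\kappa$ is "$\neq\emptyset \bmod D$" (i.e. in $D^+$) if its complement is not in $D$. The game $GM_\lambda(D)$ lasts $\lambda$ moves. At the $\xi$-th move, the first player chooses a subset $A_\xi$ of $\kappa$ with $A_\xi\subseteq\bigcap_{\eta<\xi}B_\eta$, such that if $\bigcap_{\eta<\xi}B_\eta\neq\emptyset\bmod D$ then $A_\xi\neq\emptyset\bmod D$; the second player then chooses $B_\xi\subseteq A_\xi$ with $B_\xi\neq\emptyset\bmod D$. A player without a legal move loses immediately. If the game lasts $\lambda$ moves, the second player wins iff $\bigcap_{\xi<\lambda}B_\xi$ is unbounded in $\kappa$. A subset of $[\aleph_\omega]^{<\aleph_{n^*+1}}$ (subsets of $\aleph_\omega$ of size $<\aleph_{n^*+1}$) is stationary if it meets every closed unbounded subset of $[\aleph_\omega]^{<\aleph_{n^*+1}}$.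 *)

theory Defs
  imports Complex_Main "HOL-Library.FuncSet"
begin

unbundle cardinal_syntax

text \<open>
  Ordinals are the elements of a well-ordered type, the ordinal \<open>\<alpha>\<close> being identified with its
  set \<open>{..<\<alpha>}\<close> of predecessors; a cardinal is an initial ordinal. HOL does not prove that some
  type contains all the \<open>\<omega>\<^sub>n\<close>, so the type is a parameter and \<open>alephs \<omega>\<close> is the statement that
  \<open>\<omega> n\<close> is the ordinal \<open>\<omega>\<^sub>n = \<aleph>\<^sub>n\<close> for every natural number \<open>n\<close>.
\<close>

definition initial_ordinal :: "'a::wellorder \<Rightarrow> bool" where
  "initial_ordinal \<kappa> \<longleftrightarrow> (\<forall>\<alpha><\<kappa>. |{..<\<alpha>}| <o |{..<\<kappa>}| )"

definition alephs :: "(nat \<Rightarrow> 'a::wellorder) \<Rightarrow> bool" where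
  "alephs \<omega> \<longleftrightarrow>
     (\<forall>n. initial_ordinal (\<omega> n)) \<and>
     |{..<\<omega> 0}| =o natLeq \<and>
     (\<forall>n. |{..<\<omega> (Suc n)}| =o cardSuc |{..<\<omega> n}| )"

text \<open>The set of predecessors of \<open>\<aleph>\<^sub>\<omega>\<close>, which need not itself be an element of the type.\<close>

definition aleph_omega :: "(nat \<Rightarrow> 'a::wellorder) \<Rightarrow> 'a set" where
  "aleph_omega \<omega> = (\<Union>n. {..<\<omega> n})"

definition unbounded_in :: "'a::wellorder \<Rightarrow> 'a set \<Rightarrow> bool" where
  "unbounded_in \<kappa> Y \<longleftrightarrow> (\<forall>\<alpha><\<kappa>. \<exists>\<beta>\<in>Y. \<alpha> \<le> \<beta> \<and> \<beta> < \<kappa>)"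

text \<open>
  Cofinality of a set of ordinals. The constant \<open>cofinal\<close> of \<open>Main\<close> asks for strictly larger
  elements and hence assigns no cofinal subset to a set with a maximum.
  The \<open>LEAST\<close> is meaningful when the type has an ordinal of cardinality \<open>|Y|\<close>.
\<close>

definition cf :: "'a::wellorder set \<Rightarrow> 'a" where
  "cf Y = (LEAST \<kappa>. \<exists>C\<subseteq>Y. (\<forall>y\<in>Y. \<exists>c\<in>C. y \<le> c) \<and> |C| =o |{..<\<kappa>}| )"

text \<open>
  A proper filter on \<open>\<kappa>\<close> is rendered as a filter on the type containing \<open>{..<\<kappa>}\<close>. For
  \<open>Y \<subseteq> {..<\<kappa>}\<close>, membership \<open>Y \<in> D\<close> is \<open>\<forall>\<^sub>F x in D. x \<in> Y\<close>, and \<open>Y \<noteq> \<emptyset> mod D\<close> is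
  \<open>\<exists>\<^sub>F x in D. x \<in> Y\<close>.
\<close>

definition filter_on :: "'a::wellorder \<Rightarrow> 'a filter \<Rightarrow> bool" where
  "filter_on \<kappa> D \<longleftrightarrow> D \<noteq> bot \<and> (\<forall>\<^sub>F x in D. x < \<kappa>)"

definition complete_filter :: "'a::wellorder \<Rightarrow> 'a filter \<Rightarrow> bool" where
  "complete_filter \<kappa> D \<longleftrightarrow>
     (\<forall>\<X>. |\<X>| <o |{..<\<kappa>}| \<longrightarrow> (\<forall>X\<in>\<X>. \<forall>\<^sub>F x in D. x \<in> X) \<longrightarrow> (\<forall>\<^sub>F x in D. x \<in> \<Inter>\<X>))"

definition contains_cobounded :: "'a::wellorder \<Rightarrow> 'a filter \<Rightarrow> bool" where
  "contains_cobounded \<kappa> D \<longleftrightarrow>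
     (\<forall>X\<subseteq>{..<\<kappa>}. \<not> unbounded_in \<kappa> ({..<\<kappa>} - X) \<longrightarrow> (\<forall>\<^sub>F x in D. x \<in> X))"

text \<open>
  The game \<open>GM\<^sub>\<theta>(D)\<close> for a filter \<open>D\<close> on \<open>\<kappa>\<close>: \<open>A\<close> and \<open>B\<close> are the sequences of moves of the
  first and the second player. The empty intersection at move \<open>0\<close> is \<open>\<kappa>\<close>.
\<close>

definition GM_rest :: "'a::wellorder \<Rightarrow> ('a \<Rightarrow> 'a set) \<Rightarrow> 'a \<Rightarrow> 'a set" where
  "GM_rest \<kappa> B \<xi> = {..<\<kappa>} \<inter> (\<Inter>\<eta>\<in>{..<\<xi>}. B \<eta>)"

definition GM_legal1 ::
    "'a::wellorder \<Rightarrow> 'a filter \<Rightarrow> ('a \<Rightarrow> 'a set) \<Rightarrow> ('a \<Rightarrow> 'a set) \<Rightarrow> 'a \<Rightarrow> bool" where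
  "GM_legal1 \<kappa> D A B \<xi> \<longleftrightarrow>
     A \<xi> \<subseteq> GM_rest \<kappa> B \<xi> \<and>
     ((\<exists>\<^sub>F x in D. x \<in> GM_rest \<kappa> B \<xi>) \<longrightarrow> (\<exists>\<^sub>F x in D. x \<in> A \<xi>))"

definition GM_legal2 ::
    "'a::wellorder filter \<Rightarrow> ('a \<Rightarrow> 'a set) \<Rightarrow> ('a \<Rightarrow> 'a set) \<Rightarrow> 'a \<Rightarrow> bool" where
  "GM_legal2 D A B \<xi> \<longleftrightarrow> B \<xi> \<subseteq> A \<xi> \<and> (\<exists>\<^sub>F x in D. x \<in> B \<xi>)"

text \<open>
  A strategy for the second player maps a move number \<open>\<xi>\<close> and the first player's moves
  \<open>(A\<^sub>\<eta>)\<close> for \<open>\<eta> \<le> \<xi>\<close> to the answer \<open>B\<^sub>\<xi>\<close> (the second player's earlier moves are determined by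
  these). It is winning if, as long as the first player has moved legally, the answer is a
  legal move (so that the second player never gets stuck), and in every play of full length
  \<open>\<theta>\<close> the intersection of the \<open>B\<^sub>\<xi>\<close> is unbounded in \<open>\<kappa>\<close>. The first player is never stuck,
  because \<open>GM_rest \<kappa> B \<xi>\<close> is always a legal move.
\<close>

type_synonym 'a strategy = "'a \<Rightarrow> ('a \<Rightarrow> 'a set) \<Rightarrow> 'a set"

definition GM_winning2 ::
    "'a::wellorder \<Rightarrow> 'a \<Rightarrow> 'a filter \<Rightarrow> 'a strategy \<Rightarrow> bool" where
  "GM_winning2 \<kappa> \<theta> D \<sigma> \<longleftrightarrow>
     (\<forall>A B. (\<forall>\<xi><\<theta>. B \<xi> = \<sigma> \<xi> (restrict A {..\<xi>})) \<longrightarrow>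
        (\<forall>\<xi><\<theta>. (\<forall>\<eta>\<le>\<xi>. GM_legal1 \<kappa> D A B \<eta>) \<longrightarrow> GM_legal2 D A B \<xi>) \<and>
        ((\<forall>\<xi><\<theta>. GM_legal1 \<kappa> D A B \<xi>) \<longrightarrow> unbounded_in \<kappa> (\<Inter>\<xi>\<in>{..<\<theta>}. B \<xi>)))"

text \<open>\<open>small_subsets X \<mu>\<close> is \<open>[X]\<^bsup><\<mu>\<^esup>\<close>.\<close>

definition small_subsets :: "'a::wellorder set \<Rightarrow> 'a \<Rightarrow> 'a set set" where
  "small_subsets X \<mu> = {x. x \<subseteq> X \<and> |x| <o |{..<\<mu>}| }"

definition club :: "'a::wellorder set \<Rightarrow> 'a \<Rightarrow> 'a set set \<Rightarrow> bool" where
  "club X \<mu> C \<longleftrightarrow>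
     C \<subseteq> small_subsets X \<mu> \<and>
     (\<forall>x\<in>small_subsets X \<mu>. \<exists>y\<in>C. x \<subseteq> y) \<and>
     (\<forall>K. subset.chain C K \<longrightarrow> K \<noteq> {} \<longrightarrow> |K| <o |{..<\<mu>}| \<longrightarrow> \<Union>K \<in> C)"

definition stationary :: "'a::wellorder set \<Rightarrow> 'a \<Rightarrow> 'a set set \<Rightarrow> bool" where
  "stationary X \<mu> S \<longleftrightarrow> S \<subseteq> small_subsets X \<mu> \<and> (\<forall>C. club X \<mu> C \<longrightarrow> S \<inter> C \<noteq> {})"

end

theory Submission
  imports Defs "HOL-Library.Countable_Set" "HOL-Library.Nat_Bijection"
begin

text \<open>
  Let \<open>C\<close> be a club and let the levels of a tree of finite sequences be labelled by the elements
  of \<open>A\<close>, each occurring infinitely often; a successor at a level labelled \<open>n\<close> is an ordinal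
  below \<open>\<omega>\<^sub>n\<close>. At every node \<open>s\<close> a game \<open>GM(F\<^sub>n)\<close> is played, all games simultaneously, while
  sets \<open>y\<^sub>\<xi>(s) \<in> C\<close>, increasing in \<open>\<xi>\<close> and \<open>s\<close>, are built. At stage \<open>\<xi>\<close> the first player shrinks
  the tree up to a level \<open>k\<close> so that, for one \<open>m \<notin> A\<close>, all the sets \<open>y\<^sub>\<xi>(s) \<inter> \<omega>\<^sub>m\<close> with \<open>s\<close> on level
  \<open>k\<close> have a common bound \<open>\<beta>\<^sub>\<xi> < \<omega>\<^sub>m\<close>: going down from level \<open>k\<close>, completeness of \<open>F\<^sub>n\<close> makes the
  bound constant when \<open>m < n\<close>, and a supremum is taken when \<open>n < m\<close>. The bound is put into all
  later sets. Since the second player wins all games, some branch survives all stages and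
  its entries can be chosen arbitrarily large. The union of the sets along it belongs to \<open>C\<close>; below
  \<open>\<omega>\<^sub>m\<close> the bounds \<open>\<beta>\<^sub>\<xi>\<close> are cofinal in it, and below \<open>\<omega>\<^sub>n\<close> with \<open>n \<in> A\<close> the entries of the branch are.
\<close>

section \<open>The cardinals \<open>\<aleph>\<^sub>n\<close>\<close>

lemma initial_ordinal_le_card:
  fixes \<kappa> :: "'a::wellorder"
  assumes "initial_ordinal \<kappa>" and "|{..<\<kappa>}| \<le>o |{..<\<alpha>}|"
  shows "\<kappa> \<le> \<alpha>"
  using assms not_ordLess_ordLeq unfolding initial_ordinal_def by (metis not_le)

text \<open>Any \<open>\<mu> < \<kappa>\<close> has smaller cardinality as \<open>\<kappa>\<close>
  is initial, so a cofinal set of that size would contradict \<open>small\<close>.\<close>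

lemma cf_eqI:
  fixes \<kappa> :: "'a::wellorder"
  assumes "initial_ordinal \<kappa>" and "C \<subseteq> Y" and "\<forall>y\<in>Y. \<exists>c\<in>C. y \<le> c" and "|C| =o |{..<\<kappa>}|"
    and small: "\<And>D. D \<subseteq> Y \<Longrightarrow> |D| <o |{..<\<kappa>}| \<Longrightarrow> \<exists>y\<in>Y. \<forall>d\<in>D. d < y"
  shows "cf Y = \<kappa>"
  unfolding cf_def
proof (rule Least_equality)
  show "\<exists>C\<subseteq>Y. (\<forall>y\<in>Y. \<exists>c\<in>C. y \<le> c) \<and> |C| =o |{..<\<kappa>}|"
    using assms by blast
next
  fix \<mu> :: 'a
  assume "\<exists>C\<subseteq>Y. (\<forall>y\<in>Y. \<exists>c\<in>C. y \<le> c) \<and> |C| =o |{..<\<mu>}|"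
  then obtain D where D: "D \<subseteq> Y" "\<forall>y\<in>Y. \<exists>c\<in>D. y \<le> c" "|D| =o |{..<\<mu>}|"
    by blast
  show "\<kappa> \<le> \<mu>"
  proof (rule ccontr)
    assume "\<not> \<kappa> \<le> \<mu>"
    then have "|D| <o |{..<\<kappa>}|"
      using assms(1) D(3) ordIso_ordLess_trans unfolding initial_ordinal_def by (metis not_le)
    then obtain y where "y \<in> Y" "\<forall>d\<in>D. d < y"
      using small D(1) by blast
    then show False
      using D(2) by (meson not_le)
  qed
qed

lemma unbounded_in_mono: "unbounded_in \<kappa> Y \<Longrightarrow> Y \<subseteq> Z \<Longrightarrow> unbounded_in \<kappa> Z"
  unfolding unbounded_in_def by blast

locale aleph_sequence =
  fixes \<omega> :: "nat \<Rightarrow> 'a::wellorder"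
  assumes alephs: "alephs \<omega>"
begin

lemma initial: "initial_ordinal (\<omega> n)"
  using alephs by (simp add: alephs_def)

lemma card_omega_Suc_iff: "|S| <o |{..<\<omega> (Suc n)}| \<longleftrightarrow> |S| \<le>o |{..<\<omega> n}|"
proof -
  have "|{..<\<omega> (Suc n)}| =o cardSuc |{..<\<omega> n}|"
    using alephs by (simp add: alephs_def)
  then have "|S| <o |{..<\<omega> (Suc n)}| \<longleftrightarrow> |S| <o cardSuc |{..<\<omega> n}|"
    by (meson ordIso_symmetric ordLess_ordIso_trans)
  then show ?thesis
    by (simp add: cardSuc_ordLeq_ordLess card_of_Card_order)
qed

lemma card_omega_less: "i < j \<Longrightarrow> |{..<\<omega> i}| <o |{..<\<omega> j}|"
proof (induction rule: strict_inc_induct)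
  case (base i)
  then show ?case
    by (simp add: card_omega_Suc_iff card_of_mono1)
next
  case (step i)
  have "|{..<\<omega> i}| <o |{..<\<omega> (Suc i)}|"
    by (simp add: card_omega_Suc_iff card_of_mono1)
  then show ?case
    using step ordLess_transitive by blast
qed

lemma omega_mono: "i < j \<Longrightarrow> \<omega> i < \<omega> j"
  using card_omega_less card_of_mono1 not_ordLess_ordLeq by (metis lessThan_subset_iff not_le)

lemma infinite_omega: "infinite {..<\<omega> n}"
proof -
  have "|{..<\<omega> 0}| =o natLeq"
    using alephs by (simp add: alephs_def)
  then have "natLeq \<le>o |{..<\<omega> 0}|"
    by (simp add: ordIso_iff_ordLeq)
  moreover have "|{..<\<omega> 0}| \<le>o |{..<\<omega> n}|"
    using card_omega_less[of 0 n] ordLess_imp_ordLeq by (cases n) (auto simp: card_of_mono1)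
  ultimately show ?thesis
    using infinite_iff_natLeq_ordLeq ordLeq_transitive by blast
qed

lemma card_Un_le_omega:
  "|z| \<le>o |{..<\<omega> n}| \<Longrightarrow> |w| \<le>o |{..<\<omega> n}| \<Longrightarrow> |z \<union> w| \<le>o |{..<\<omega> n}|"
  by (rule card_of_Un_ordLeq_infinite_Field)
    (simp_all add: infinite_omega Field_card_of card_of_card_order_on)

text \<open>Regularity of the successor cardinal \<open>\<omega> m\<close>: an unbounded
  \<open>S\<close> would make it a union of too few sets of size at most \<open>\<omega> j\<close>,
  where \<open>m = Suc j\<close>.\<close>

lemma omega_bounded:
  assumes "i < m" and "S \<subseteq> {..<\<omega> m}" and "|S| \<le>o |{..<\<omega> i}|"
  shows "\<exists>\<beta><\<omega> m. \<forall>z\<in>S. z < \<beta>"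
proof (rule ccontr)
  assume no: "\<not> ?thesis"
  obtain j where m: "m = Suc j" and "i \<le> j"
    using assms(1) by (metis less_Suc_eq_le less_imp_Suc_add le_add1)
  then have S: "|S| \<le>o |{..<\<omega> j}|"
    using assms(3) card_omega_less[of i j] ordLess_imp_ordLeq ordLeq_transitive
    by (cases "i = j") (auto, blast)
  have "{..<\<omega> m} \<subseteq> (\<Union>z\<in>S. {..z})"
    using no by (fastforce simp: not_less)
  moreover have "|{..z}| \<le>o |{..<\<omega> j}|" if "z \<in> S" for z
  proof -
    have "|{..<z}| <o |{..<\<omega> m}|"
      using that assms(2) initial unfolding initial_ordinal_def by auto
    then have "|{..<z}| \<le>o |{..<\<omega> j}|"
      by (simp add: m card_omega_Suc_iff)
    moreover have "|{z}| \<le>o |{..<\<omega> j}|"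
      using infinite_omega card_of_singl_ordLeq by (metis finite.emptyI)
    moreover have "{..z} = {..<z} \<union> {z}"
      by auto
    ultimately show ?thesis
      using card_Un_le_omega by metis
  qed
  then have "|\<Union>z\<in>S. {..z}| \<le>o |{..<\<omega> j}|"
    by (intro card_of_UNION_ordLeq_infinite infinite_omega S ballI)
  ultimately have "|{..<\<omega> m}| \<le>o |{..<\<omega> j}|"
    using card_of_mono1 ordLeq_transitive by blast
  then show False
    using card_omega_less[of j m] m not_ordLess_ordLeq by blast
qed

text \<open>The second coordinate of a bijection with \<open>{..<\<omega> n} \<times> UNIV\<close>
  has fibres of full size, and these fit into no proper initial segment of an initial
  ordinal.\<close>

lemma unbounded_fibres: "\<exists>p. \<forall>k::nat. \<forall>\<alpha><\<omega> n. \<exists>\<xi>\<ge>\<alpha>. \<xi> < \<omega> n \<and> p \<xi> = k"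
proof -
  have "|{..<\<omega> n} \<times> (UNIV :: nat set)| =o |{..<\<omega> n}|"
    using infinite_omega infinite_iff_card_of_nat card_of_Times_infinite by blast
  then obtain f where f: "bij_betw f ({..<\<omega> n} \<times> (UNIV :: nat set)) {..<\<omega> n}"
    using card_of_ordIso by blast
  define p where "p \<xi> = snd (inv_into ({..<\<omega> n} \<times> (UNIV :: nat set)) f \<xi>)" for \<xi>
  have pf: "p (f (u, k)) = k" "f (u, k) < \<omega> n" if "u < \<omega> n" for u k
    using f that unfolding p_def bij_betw_def by (auto simp: inv_into_f_f)
  have "\<exists>\<xi>\<ge>\<alpha>. \<xi> < \<omega> n \<and> p \<xi> = k" if "\<alpha> < \<omega> n" for k \<alpha>
  proof (rule ccontr)
    assume "\<not> ?thesis"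
    then have "(\<lambda>u. f (u, k)) ` {..<\<omega> n} \<subseteq> {..<\<alpha>}"
      using pf by (force simp: not_le[symmetric])
    moreover have "inj_on (\<lambda>u. f (u, k)) {..<\<omega> n}"
      using f unfolding bij_betw_def inj_on_def by auto
    ultimately have "|{..<\<omega> n}| \<le>o |{..<\<alpha>}|"
      using card_of_ordLeq by blast
    then show False
      using initial_ordinal_le_card initial that by (meson not_le)
  qed
  then show ?thesis
    by (intro exI[of _ p]) simp
qed

end

section \<open>Shrinking a tree of positive sets\<close>

text \<open>Were the remaining set null, the empty set would be a legal move of the first player
  that no positive set can answer.\<close>

lemma GM_winning2_rest_frequently:
  assumes win: "GM_winning2 \<kappa> \<theta> D \<sigma>" and "\<xi> < \<theta>"
    and legal: "\<And>\<eta>. \<eta> < \<xi> \<Longrightarrow> GM_legal1 \<kappa> D A (\<lambda>\<eta>. \<sigma> \<eta> (restrict A {..\<eta>})) \<eta>"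
  shows "\<exists>\<^sub>F x in D. x \<in> GM_rest \<kappa> (\<lambda>\<eta>. \<sigma> \<eta> (restrict A {..\<eta>})) \<xi>"
proof (rule ccontr)
  assume no: "\<not> ?thesis"
  define A' where "A' = A(\<xi> := {})"
  define B where "B = (\<lambda>\<eta>. \<sigma> \<eta> (restrict A {..\<eta>}))"
  define B' where "B' = (\<lambda>\<eta>. \<sigma> \<eta> (restrict A' {..\<eta>}))"
  \<comment> \<open>A strategy sees only the moves made so far, so altering move
    \<open>\<xi>\<close> leaves the earlier answers unchanged.\<close>
  have "restrict A' {..\<eta>} = restrict A {..\<eta>}" if "\<eta> < \<xi>" for \<eta>
    using that by (auto simp: A'_def restrict_def fun_eq_iff)
  then have BB: "B' \<eta> = B \<eta>" if "\<eta> < \<xi>" for \<eta>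
    using that by (simp add: B_def B'_def)
  have rest: "GM_rest \<kappa> B' \<eta> = GM_rest \<kappa> B \<eta>" if "\<eta> \<le> \<xi>" for \<eta>
    using that by (auto simp: GM_rest_def BB)
  have "GM_legal1 \<kappa> D A' B' \<eta>" if "\<eta> \<le> \<xi>" for \<eta>
  proof (cases "\<eta> = \<xi>")
    case True
    then show ?thesis
      using no rest[of \<xi>] by (simp add: GM_legal1_def A'_def B_def)
  next
    case False
    then show ?thesis
      using that legal[of \<eta>] rest[of \<eta>] by (simp add: GM_legal1_def A'_def B_def)
  qed
  moreover have "\<forall>\<eta><\<theta>. B' \<eta> = \<sigma> \<eta> (restrict A' {..\<eta>})"
    by (simp add: B'_def)
  ultimately have "GM_legal2 D A' B' \<xi>"
    using win \<open>\<xi> < \<theta>\<close> unfolding GM_winning2_def by blast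
  then show False
    by (auto simp: GM_legal2_def A'_def)
qed

text \<open>Otherwise the complements of all fibres, fewer than \<open>\<kappa>\<close> many, would
  intersect in a set of the filter that misses \<open>R\<close>.\<close>

lemma complete_filter_pigeonhole:
  assumes "complete_filter \<kappa> D" and "|I| <o |{..<\<kappa>}|"
    and "\<exists>\<^sub>F x in D. x \<in> R" and "\<And>x. x \<in> R \<Longrightarrow> b x \<in> I"
  shows "\<exists>i\<in>I. \<exists>\<^sub>F x in D. x \<in> R \<and> b x = i"
proof (rule ccontr)
  assume "\<not> ?thesis"
  then have ev: "\<forall>\<^sub>F x in D. x \<in> {x. \<not> (x \<in> R \<and> b x = i)}" if "i \<in> I" for i
    using that by (simp add: not_frequently)
  let ?X = "(\<lambda>i. {x. \<not> (x \<in> R \<and> b x = i)}) ` I"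
  have "|?X| <o |{..<\<kappa>}|"
    using assms(2) card_of_image ordLeq_ordLess_trans by blast
  then have "\<forall>\<^sub>F x in D. x \<in> \<Inter>?X"
    using assms(1) ev unfolding complete_filter_def by blast
  then have "\<forall>\<^sub>F x in D. x \<notin> R"
    by (rule eventually_mono) (use assms(4) in auto)
  then show False
    using assms(3) by (simp add: frequently_def)
qed

text \<open>Nodes of a tree are lists with the most recent element first.\<close>

fun on_tree :: "('a list \<Rightarrow> 'a set) \<Rightarrow> 'a list \<Rightarrow> bool" where
  "on_tree T [] \<longleftrightarrow> True"
| "on_tree T (a # s) \<longleftrightarrow> a \<in> T s \<and> on_tree T s"

text \<open>Only proper tails of \<open>s\<close> are consulted, so the moves at a level can be
  replaced without changing which nodes of that level are on the tree.\<close>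

lemma on_tree_cong:
  "(\<And>t. length t < length s \<Longrightarrow> T t = T' t) \<Longrightarrow> on_tree T s \<longleftrightarrow> on_tree T' s"
proof (induction s)
  case (Cons a s)
  have "on_tree T s \<longleftrightarrow> on_tree T' s"
    by (rule Cons.IH) (use Cons.prems in auto)
  then show ?case
    using Cons.prems[of s] by simp
qed simp

text \<open>\<open>G\<close> stands for a choice of a club member containing a given set; adding the
  parent's set makes the values increase along branches.\<close>

primrec node_set :: "('a set \<Rightarrow> 'a set) \<Rightarrow> ('a list \<Rightarrow> 'a set) \<Rightarrow> 'a list \<Rightarrow> 'a set" where
  "node_set G P [] = G (P [])"
| "node_set G P (a # s) = G (P (a # s) \<union> node_set G P s)"

context aleph_sequence
begin

text \<open>For \<open>m < n\<close> the pigeonhole principle makes \<open>b\<close> constant on a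
  positive set; for \<open>n < m\<close> regularity bounds \<open>b\<close> on all of
  \<open>R\<close>. Neither argument covers \<open>n = m\<close>.\<close>

lemma bounded_on_positive_set:
  assumes "n \<noteq> m" and "complete_filter (\<omega> n) D"
    and "\<exists>\<^sub>F x in D. x \<in> R" and "R \<subseteq> {..<\<omega> n}" and "\<And>x. b x < \<omega> m"
  shows "\<exists>\<beta><\<omega> m. \<exists>T\<subseteq>R. (\<exists>\<^sub>F x in D. x \<in> T) \<and> (\<forall>x\<in>T. b x \<le> \<beta>)"
proof (cases "m < n")
  case True
  then obtain \<beta> where "\<beta> < \<omega> m" "\<exists>\<^sub>F x in D. x \<in> R \<and> b x = \<beta>"
    using complete_filter_pigeonhole[OF assms(2), of "{..<\<omega> m}" R b] assms(3,5) card_omega_less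
    by auto
  then show ?thesis
    by (intro exI[of _ \<beta>] conjI exI[of _ "{x \<in> R. b x = \<beta>}"]) auto
next
  case False
  then have "n < m"
    using assms(1) by simp
  moreover have "|b ` {..<\<omega> n}| \<le>o |{..<\<omega> n}|"
    by (rule card_of_image)
  ultimately obtain \<beta> where "\<beta> < \<omega> m" "\<forall>z\<in>b ` {..<\<omega> n}. z < \<beta>"
    using omega_bounded[of n m "b ` {..<\<omega> n}"] assms(5) by blast
  then show ?thesis
    using assms(3,4) by (intro exI[of _ \<beta>] conjI exI[of _ R]) (auto intro: less_imp_le)
qed

text \<open>Induction on \<open>k\<close> removes the last entry first: at each node of level
  \<open>k\<close> one bound is found for its remaining children, and these bounds form the new
  function to be bounded.\<close>

lemma bounded_on_subtree:
  fixes N :: "nat \<Rightarrow> nat" and F :: "nat \<Rightarrow> 'a filter"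
  assumes "\<And>i. i < k \<Longrightarrow> N i \<noteq> m \<and> complete_filter (\<omega> (N i)) (F (N i))"
    and "\<And>s. N (length s) \<in> A \<Longrightarrow>
           R s \<subseteq> {..<\<omega> (N (length s))} \<and> (\<exists>\<^sub>F x in F (N (length s)). x \<in> R s)"
    and "\<And>i. i < k \<Longrightarrow> N i \<in> A"
    and "\<And>s. b s < \<omega> m"
  shows "\<exists>\<beta><\<omega> m. \<exists>T. (\<forall>s. N (length s) \<in> A \<longrightarrow> T s \<subseteq> R s \<and> (\<exists>\<^sub>F x in F (N (length s)). x \<in> T s)) \<and>
           (\<forall>s. length s = k \<longrightarrow> on_tree T s \<longrightarrow> b s \<le> \<beta>)"
  using assms(1,3,4)
proof (induction k arbitrary: b)
  case 0
  then show ?case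
    using assms(2) by (intro exI[of _ "b []"] conjI exI[of _ R]) auto
next
  case (Suc k)
  have "\<exists>c U. length s = k \<longrightarrow> c < \<omega> m \<and> U \<subseteq> R s \<and> (\<exists>\<^sub>F x in F (N k). x \<in> U) \<and>
          (\<forall>a\<in>U. b (a # s) \<le> c)" for s
  proof (cases "length s = k")
    case True
    then show ?thesis
      using bounded_on_positive_set[of "N k" m "F (N k)" "R s" "\<lambda>a. b (a # s)"]
        Suc.prems(1)[of k] Suc.prems(2)[of k] Suc.prems(3) assms(2)[of s] by blast
  qed simp
  then obtain c U where U: "\<And>s. length s = k \<Longrightarrow> c s < \<omega> m \<and> U s \<subseteq> R s \<and>
      (\<exists>\<^sub>F x in F (N k). x \<in> U s) \<and> (\<forall>a\<in>U s. b (a # s) \<le> c s)"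
    by metis
  \<comment> \<open>Off level \<open>k\<close> the value only has to stay below
    \<open>\<omega> m\<close>.\<close>
  define b' where "b' s = (if length s = k then c s else b s)" for s
  have "b' s < \<omega> m" for s
    using U Suc.prems(3) by (simp add: b'_def)
  then obtain \<beta> T where \<beta>: "\<beta> < \<omega> m"
    and T: "\<forall>s. N (length s) \<in> A \<longrightarrow> T s \<subseteq> R s \<and> (\<exists>\<^sub>F x in F (N (length s)). x \<in> T s)"
    and bT: "\<forall>s. length s = k \<longrightarrow> on_tree T s \<longrightarrow> b' s \<le> \<beta>"
    using Suc.IH[of b'] Suc.prems(1,2) by (metis less_SucI)
  define T' where "T' s = (if length s = k then U s else T s)" for s
  have "b s \<le> \<beta>" if len: "length s = Suc k" and on: "on_tree T' s" for s
  proof -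
    obtain a t where s: "s = a # t" "length t = k"
      using len by (auto simp: length_Suc_conv)
    have "on_tree T t"
      using on s on_tree_cong[of t T T'] by (simp add: T'_def)
    then have "c t \<le> \<beta>"
      using bT s(2) by (auto simp: b'_def)
    moreover have "b s \<le> c t"
      using on s U by (auto simp: T'_def)
    ultimately show ?thesis
      by simp
  qed
  moreover have "\<forall>s. N (length s) \<in> A \<longrightarrow> T' s \<subseteq> R s \<and> (\<exists>\<^sub>F x in F (N (length s)). x \<in> T' s)"
    using T U by (simp add: T'_def)
  ultimately show ?case
    using \<beta> by (intro exI[of _ \<beta>] conjI exI[of _ T']) auto
qed

end

section \<open>Playing the games at all nodes\<close>

text \<open>\<open>N\<close> labels the levels of the tree, and \<open>p\<close> gives stage
  \<open>\<xi>\<close> its task \<open>(k, m)\<close>, each task recurring unboundedly often.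
  \<open>N_range\<close> is conditional to include \<open>A = {}\<close>.\<close>

locale stationary_game = aleph_sequence \<omega> for \<omega> :: "nat \<Rightarrow> 'a::wellorder" +
  fixes A :: "nat set" and nstar :: nat and C :: "'a set set"
    and F :: "nat \<Rightarrow> 'a filter" and \<sigma> :: "nat \<Rightarrow> 'a strategy"
    and N :: "nat \<Rightarrow> nat" and p :: "'a \<Rightarrow> nat \<times> nat"
  assumes nstar_pos: "0 < nstar"
    and above: "n \<in> A \<Longrightarrow> nstar < n"
    and club: "club (aleph_omega \<omega>) (\<omega> (Suc nstar)) C"
    and complete: "n \<in> A \<Longrightarrow> complete_filter (\<omega> n) (F n)"
    and win: "n \<in> A \<Longrightarrow> GM_winning2 (\<omega> n) (\<omega> nstar) (F n) (\<sigma> n)"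
    and N_range: "A \<noteq> {} \<Longrightarrow> N i \<in> A"
    and N_surj: "n \<in> A \<Longrightarrow> \<exists>i\<ge>k. N i = n"
    and p_fibres: "\<alpha> < \<omega> nstar \<Longrightarrow> \<exists>\<xi>\<ge>\<alpha>. \<xi> < \<omega> nstar \<and> p \<xi> = q"
begin

abbreviation X :: "'a set" where "X \<equiv> aleph_omega \<omega>"

abbreviation small :: "'a set \<Rightarrow> bool" where "small z \<equiv> |z| \<le>o |{..<\<omega> nstar}|"

lemma omega_subset_X: "{..<\<omega> n} \<subseteq> X"
  by (auto simp: aleph_omega_def)

lemma small_subsets_iff: "z \<in> small_subsets X (\<omega> (Suc nstar)) \<longleftrightarrow> z \<subseteq> X \<and> small z"
  by (simp add: small_subsets_def card_omega_Suc_iff)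

lemma C_D: "z \<in> C \<Longrightarrow> z \<subseteq> X \<and> small z"
  using club small_subsets_iff by (auto simp: club_def)

lemma C_chain:
  assumes "K \<subseteq> C" and "\<And>x y. x \<in> K \<Longrightarrow> y \<in> K \<Longrightarrow> x \<subseteq> y \<or> y \<subseteq> x" and "K \<noteq> {}"
    and "|K| \<le>o |{..<\<omega> nstar}|"
  shows "\<Union>K \<in> C"
proof -
  have "subset.chain C K"
    using assms(1,2) by (auto simp: subset_chain_def)
  moreover have "|K| <o |{..<\<omega> (Suc nstar)}|"
    using assms(4) by (simp add: card_omega_Suc_iff)
  ultimately show ?thesis
    using club assms(3) by (simp add: club_def)
qed

lemma small_mono: "z \<subseteq> w \<Longrightarrow> small w \<Longrightarrow> small z"
  using card_of_mono1 ordLeq_transitive by metis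

lemma finite_small:
  assumes "finite z"
  shows "small z"
proof -
  have "|z| <o |{..<\<omega> nstar}|"
    by (rule finite_ordLess_infinite)
      (simp_all add: assms infinite_omega Field_card_of card_of_well_order_on)
  then show ?thesis
    by (rule ordLess_imp_ordLeq)
qed

lemma small_initial_segment: "\<xi> < \<omega> nstar \<Longrightarrow> |{..<\<xi>}| \<le>o |{..<\<omega> nstar}|"
  by (intro card_of_mono1) auto

section \<open>Stages of the simultaneous play\<close>

definition reply :: "nat \<Rightarrow> ('a \<Rightarrow> 'a set) \<Rightarrow> 'a \<Rightarrow> 'a set" where
  "reply n M \<eta> = \<sigma> n \<eta> (restrict M {..\<eta>})"

text \<open>
  At stage \<open>\<xi>\<close> a triple \<open>(\<beta>, y, T)\<close> is chosen: \<open>y s\<close> is a member of the club attached to the node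
  \<open>s\<close>, \<open>T s\<close> is the move of the first player in the game played at \<open>s\<close>, and \<open>\<beta>\<close> is a bound below
  \<open>\<omega>\<^sub>m\<close> for all the sets \<open>y s \<inter> \<omega>\<^sub>m\<close> with \<open>s\<close> on level \<open>k\<close> of the tree \<open>T\<close>, where \<open>(k, m) = p \<xi>\<close>.
\<close>

definition bnd :: "'a \<times> ('a list \<Rightarrow> 'a set) \<times> ('a list \<Rightarrow> 'a set) \<Rightarrow> 'a" where
  "bnd r = fst r"

definition pt :: "'a \<times> ('a list \<Rightarrow> 'a set) \<times> ('a list \<Rightarrow> 'a set) \<Rightarrow> 'a list \<Rightarrow> 'a set" where
  "pt r = fst (snd r)"

definition tr :: "'a \<times> ('a list \<Rightarrow> 'a set) \<times> ('a list \<Rightarrow> 'a set) \<Rightarrow> 'a list \<Rightarrow> 'a set" where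
  "tr r = snd (snd r)"

definition rest where
  "rest f \<xi> s = GM_rest (\<omega> (N (length s))) (reply (N (length s)) (\<lambda>\<eta>. tr (f \<eta>) s)) \<xi>"

text \<open>The shrinking argument fails at levels labelled \<open>m\<close>, hence
  \<open>m \<notin> A\<close>. For \<open>A = {}\<close> the branch stays at the root, so only level
  \<open>0\<close> is served.\<close>

definition good :: "'a \<Rightarrow> nat \<Rightarrow> nat \<Rightarrow> bool" where
  "good \<xi> k m \<longleftrightarrow> p \<xi> = (k, m) \<and> (k = 0 \<or> A \<noteq> {}) \<and> nstar < m \<and> m \<notin> A"

text \<open>The guard lets the recursion run over the whole type. Keeping earlier bounds in
  \<open>pt r s\<close> is what makes the bounds for one \<open>m\<close> increase.\<close>

definition stage where
  "stage f \<xi> r \<longleftrightarrow> (\<xi> < \<omega> nstar \<longrightarrow>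
     bnd r \<in> X \<and>
     (\<forall>s. set s \<subseteq> X \<longrightarrow> pt r s \<in> C \<and> set s \<subseteq> pt r s \<and>
        (\<forall>\<eta><\<xi>. bnd (f \<eta>) \<in> pt r s \<and> pt (f \<eta>) s \<subseteq> pt r s) \<and>
        (\<forall>a t. s = a # t \<longrightarrow> pt r t \<subseteq> pt r s)) \<and>
     (\<forall>s. N (length s) \<in> A \<longrightarrow>
        tr r s \<subseteq> rest f \<xi> s \<and> (\<exists>\<^sub>F x in F (N (length s)). x \<in> tr r s)) \<and>
     (\<forall>k m. good \<xi> k m \<longrightarrow> bnd r < \<omega> m \<and>
        (\<forall>s. length s = k \<longrightarrow> on_tree (tr r) s \<longrightarrow> (\<forall>z\<in>pt r s. z < \<omega> m \<longrightarrow> z < bnd r))))"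

lemma rest_cong:
  assumes "\<And>\<eta>. \<eta> < \<xi> \<Longrightarrow> f \<eta> = g \<eta>"
  shows "rest f \<xi> s = rest g \<xi> s"
proof -
  have "restrict (\<lambda>\<eta>. tr (f \<eta>) s) {..\<eta>} = restrict (\<lambda>\<eta>. tr (g \<eta>) s) {..\<eta>}" if "\<eta> < \<xi>" for \<eta>
    using that assms by (auto simp: restrict_def fun_eq_iff)
  then show ?thesis
    by (simp add: rest_def GM_rest_def reply_def)
qed

lemma stage_cong:
  assumes "\<And>\<eta>. \<eta> < \<xi> \<Longrightarrow> f \<eta> = g \<eta>"
  shows "stage f \<xi> r = stage g \<xi> r"
  using assms rest_cong[of \<xi> f g] by (simp add: stage_def)

lemma stage_legal1:
  assumes "stage f \<eta> (f \<eta>)" and "\<eta> < \<omega> nstar" and "N (length s) \<in> A"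
  shows "GM_legal1 (\<omega> (N (length s))) (F (N (length s))) (\<lambda>\<eta>. tr (f \<eta>) s)
           (reply (N (length s)) (\<lambda>\<eta>. tr (f \<eta>) s)) \<eta>"
  using assms by (simp add: stage_def GM_legal1_def rest_def)

lemma rest_positive:
  assumes "\<And>\<eta>. \<eta> < \<xi> \<Longrightarrow> stage f \<eta> (f \<eta>)" and "\<xi> < \<omega> nstar" and "N (length s) \<in> A"
  shows "\<exists>\<^sub>F x in F (N (length s)). x \<in> rest f \<xi> s"
  unfolding rest_def reply_def
proof (rule GM_winning2_rest_frequently[OF win[OF assms(3)] assms(2)])
  fix \<eta> assume "\<eta> < \<xi>"
  then show "GM_legal1 (\<omega> (N (length s))) (F (N (length s))) (\<lambda>\<eta>. tr (f \<eta>) s)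
      (\<lambda>\<eta>. \<sigma> (N (length s)) \<eta> (restrict (\<lambda>\<eta>. tr (f \<eta>) s) {..\<eta>})) \<eta>"
    using stage_legal1[of f \<eta> s] assms unfolding reply_def by simp
qed

lemma on_tree_subset_X:
  assumes "\<And>i. i < length s \<Longrightarrow> N i \<in> A"
    and "\<And>s. N (length s) \<in> A \<Longrightarrow> T s \<subseteq> rest f \<xi> s" and "on_tree T s"
  shows "set s \<subseteq> X"
  using assms(1,3)
proof (induction s)
  case (Cons a s)
  have "a \<in> rest f \<xi> s"
    using Cons.prems assms(2)[of s] by auto
  then have "a \<in> X"
    using omega_subset_X by (auto simp: rest_def GM_rest_def)
  then show ?case
    using Cons by simp
qed simp

text \<open>The club sets \<open>y\<close> are fixed first; only then can the trees be shrunk so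
  that one bound serves them all on level \<open>k\<close>.\<close>

lemma stage_exists:
  assumes prev: "\<And>\<eta>. \<eta> < \<xi> \<Longrightarrow> stage f \<eta> (f \<eta>)"
  shows "\<exists>r. stage f \<xi> r"
proof (cases "\<xi> < \<omega> nstar")
  case False
  then show ?thesis
    by (simp add: stage_def)
next
  case True
  obtain G where G: "\<And>z. z \<subseteq> X \<Longrightarrow> small z \<Longrightarrow> G z \<in> C \<and> z \<subseteq> G z"
    using club small_subsets_iff unfolding club_def by metis
  define P where "P s = (\<lambda>\<eta>. bnd (f \<eta>)) ` {..<\<xi>} \<union> set s \<union> (\<Union>\<eta>\<in>{..<\<xi>}. pt (f \<eta>) s)" for s
  have P: "P s \<subseteq> X \<and> small (P s)" if "set s \<subseteq> X" for s
  proof -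
    have \<eta>: "bnd (f \<eta>) \<in> X" "pt (f \<eta>) s \<in> C" if "\<eta> < \<xi>" for \<eta>
      using prev[OF that] that True \<open>set s \<subseteq> X\<close> by (auto simp: stage_def)
    have "small ((\<lambda>\<eta>. bnd (f \<eta>)) ` {..<\<xi>})"
      using card_of_image small_initial_segment[OF True] ordLeq_transitive by blast
    moreover have "small (\<Union>\<eta>\<in>{..<\<xi>}. pt (f \<eta>) s)"
      using \<eta>(2) C_D small_initial_segment[OF True]
      by (intro card_of_UNION_ordLeq_infinite infinite_omega) auto
    ultimately have "small (P s)"
      by (simp add: P_def card_Un_le_omega finite_small)
    then show ?thesis
      using \<eta> C_D that by (auto simp: P_def)
  qed
  define y where "y = node_set G P"
  have y: "y s \<in> C \<and> P s \<subseteq> y s \<and> (\<forall>a t. s = a # t \<longrightarrow> y t \<subseteq> y s)" if "set s \<subseteq> X" for s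
    using that
  proof (induction s)
    case Nil
    then show ?case
      using G P[of "[]"] by (simp add: y_def)
  next
    case (Cons a s)
    then have "y s \<subseteq> X" "small (y s)"
      using C_D by auto
    then have "P (a # s) \<union> y s \<subseteq> X" "small (P (a # s) \<union> y s)"
      using P[OF Cons.prems] card_Un_le_omega by auto
    from G[OF this] show ?case
      by (simp add: y_def)
  qed
  have rest: "rest f \<xi> s \<subseteq> {..<\<omega> (N (length s))} \<and> (\<exists>\<^sub>F x in F (N (length s)). x \<in> rest f \<xi> s)"
    if "N (length s) \<in> A" for s
    using rest_positive[OF prev True that] by (auto simp: rest_def GM_rest_def)
  obtain \<beta> T where \<beta>: "\<beta> \<in> X"
    and T: "\<And>s. N (length s) \<in> A \<Longrightarrow>
              T s \<subseteq> rest f \<xi> s \<and> (\<exists>\<^sub>F x in F (N (length s)). x \<in> T s)"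
    and bT: "\<And>k m. good \<xi> k m \<Longrightarrow> \<beta> < \<omega> m \<and>
        (\<forall>s. length s = k \<longrightarrow> on_tree T s \<longrightarrow> (\<forall>z\<in>y s. z < \<omega> m \<longrightarrow> z < \<beta>))"
  proof (cases "\<exists>k m. good \<xi> k m")
    case False
    \<comment> \<open>Without a task the whole remaining set is played, and
      \<open>\<omega> 0\<close> is an arbitrary element of \<open>X\<close>.\<close>
    moreover have "\<omega> 0 \<in> X"
      using omega_subset_X[of 1] omega_mono[of 0 1] by auto
    ultimately show ?thesis
      using rest by (intro that[of "\<omega> 0" "rest f \<xi>"]) auto
  next
    case True
    then obtain k m where km: "good \<xi> k m"
      by blast
    then have uniq: "k' = k \<and> m' = m" if "good \<xi> k' m'" for k' m'
      using that by (simp add: good_def)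
    have NA: "N i \<in> A" if "i < k" for i
      using km N_range that by (auto simp: good_def)
    have m: "nstar < m" "m \<notin> A"
      using km by (auto simp: good_def)
    \<comment> \<open>Each \<open>y s\<close> is small and \<open>nstar < m\<close>, so regularity
      applies; outside \<open>X\<close> any value such as \<open>\<omega> nstar\<close> will
      do.\<close>
    have "\<exists>b<\<omega> m. set s \<subseteq> X \<longrightarrow> (\<forall>z\<in>y s. z < \<omega> m \<longrightarrow> z < b)" for s
    proof (cases "set s \<subseteq> X")
      case True
      then have "small (y s \<inter> {..<\<omega> m})"
        using y[OF True] C_D[of "y s"] by (auto intro: small_mono[of _ "y s"])
      then show ?thesis
        using omega_bounded[OF m(1), of "y s \<inter> {..<\<omega> m}"] by auto
    next
      case False
      then show ?thesis
        using m omega_mono[of nstar m] by auto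
    qed
    then obtain b where b: "\<And>s. b s < \<omega> m"
      "\<And>s z. set s \<subseteq> X \<Longrightarrow> z \<in> y s \<Longrightarrow> z < \<omega> m \<Longrightarrow> z < b s"
      by metis
    have "N i \<noteq> m \<and> complete_filter (\<omega> (N i)) (F (N i))"
      if "i < k" for i
      using NA[OF that] m complete by auto
    from bounded_on_subtree[where k = k and R = "rest f \<xi>" and A = A and b = b and N = N and F = F,
        OF this rest NA b(1)]
    obtain \<beta> T where \<beta>: "\<beta> < \<omega> m"
      and T: "\<And>s. N (length s) \<in> A \<Longrightarrow>
              T s \<subseteq> rest f \<xi> s \<and> (\<exists>\<^sub>F x in F (N (length s)). x \<in> T s)"
      and bT: "\<And>s. length s = k \<Longrightarrow> on_tree T s \<Longrightarrow> b s \<le> \<beta>"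
      by auto
    have "z < \<beta>" if "length s = k" "on_tree T s" "z \<in> y s" "z < \<omega> m" for s z
    proof -
      have "set s \<subseteq> X"
        using on_tree_subset_X[of s T f \<xi>] NA T that by blast
      then show ?thesis
        using b(2)[of s z] bT[of s] that by auto
    qed
    then show ?thesis
      using \<beta> T omega_subset_X[of m] uniq by (intro that[of \<beta> T]) blast+
  qed
  have "bnd (f \<eta>) \<in> P s \<and> pt (f \<eta>) s \<subseteq> P s \<and> set s \<subseteq> P s" if "\<eta> < \<xi>" for s \<eta>
    using that by (auto simp: P_def)
  then have "\<forall>s. set s \<subseteq> X \<longrightarrow> y s \<in> C \<and> set s \<subseteq> y s \<and>
      (\<forall>\<eta><\<xi>. bnd (f \<eta>) \<in> y s \<and> pt (f \<eta>) s \<subseteq> y s) \<and>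
      (\<forall>a t. s = a # t \<longrightarrow> y t \<subseteq> y s)"
    using y P_def by blast
  moreover have "bnd (\<beta>, y, T) = \<beta>" "pt (\<beta>, y, T) = y" "tr (\<beta>, y, T) = T"
    by (simp_all add: bnd_def pt_def tr_def)
  ultimately have "stage f \<xi> (\<beta>, y, T)"
    using \<beta> T bT unfolding stage_def by simp
  then show ?thesis
    by blast
qed

text \<open>
  The branch \<open>b 0, b 1, \<dots>\<close> stays in all the trees, and the element added at step \<open>k\<close> exceeds
  everything that \<open>b k\<close> has generated below \<open>\<omega>\<^sub>n\<close>, where \<open>n = N k\<close>. For \<open>A = {}\<close> the branch
  is constantly the root.
\<close>

lemma exists_cofinalities:
  "\<exists>x\<in>C. (\<forall>n\<in>A. cf (x \<inter> {..<\<omega> n}) = \<omega> 0) \<and>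
          (\<forall>n. nstar < n \<and> n \<notin> A \<longrightarrow> cf (x \<inter> {..<\<omega> n}) = \<omega> nstar)"
proof -
  have "\<exists>f. \<forall>\<xi>. stage f \<xi> (f \<xi>)"
  proof (rule dependent_wf_choice[where P = stage, OF wf])
    show "stage f \<xi> r = stage g \<xi> r"
      if "\<And>\<eta>. (\<eta>, \<xi>) \<in> {(x, y). x < y} \<Longrightarrow> f \<eta> = g \<eta>" for f g \<xi> r
      by (rule stage_cong) (use that in simp)
    show "\<exists>r. stage f \<xi> r"
      if "\<And>\<eta>. (\<eta>, \<xi>) \<in> {(x, y). x < y} \<Longrightarrow> stage f \<eta> (f \<eta>)" for f \<xi>
      by (rule stage_exists) (use that in simp)
  qed
  then obtain f where f: "\<And>\<xi>. stage f \<xi> (f \<xi>)"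
    by blast
  have ptC: "pt (f \<xi>) s \<in> C" and set_pt: "set s \<subseteq> pt (f \<xi>) s"
    if "\<xi> < \<omega> nstar" "set s \<subseteq> X" for \<xi> s
    using f[of \<xi>] that by (auto simp: stage_def)
  have pt_mono: "pt (f \<eta>) s \<subseteq> pt (f \<xi>) s" if "\<eta> \<le> \<xi>" "\<xi> < \<omega> nstar" "set s \<subseteq> X" for \<eta> \<xi> s
    using f[of \<xi>] that by (cases "\<eta> = \<xi>") (auto simp: stage_def)
  have pt_Cons: "pt (f \<xi>) s \<subseteq> pt (f \<xi>) (a # s)"
    if "\<xi> < \<omega> nstar" "set (a # s) \<subseteq> X" for \<xi> s a
    using f[of \<xi>] that unfolding stage_def by blast
  have bnd_pt: "bnd (f \<eta>) \<in> pt (f \<xi>) s" if "\<eta> < \<xi>" "\<xi> < \<omega> nstar" "set s \<subseteq> X" for \<eta> \<xi> s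
    using f[of \<xi>] that by (auto simp: stage_def)
  have bnd_less: "bnd (f \<xi>) < \<omega> m" if "\<xi> < \<omega> nstar" "good \<xi> k m" for \<xi> k m
    using f[of \<xi>] that by (auto simp: stage_def)
  have less_bnd: "z < bnd (f \<xi>)"
    if "\<xi> < \<omega> nstar" "good \<xi> (length s) m" "on_tree (tr (f \<xi>)) s" "z \<in> pt (f \<xi>) s" "z < \<omega> m"
    for \<xi> s m z
    using f[of \<xi>] that by (auto simp: stage_def)
  \<comment> \<open>The trees at \<open>s\<close> form a full play against the winning strategy,
    whose answers lie inside the moves \<open>tr (f \<xi>) s\<close>.\<close>
  have unb: "unbounded_in (\<omega> (N (length s))) (\<Inter>\<xi>\<in>{..<\<omega> nstar}. tr (f \<xi>) s)"
    if s: "N (length s) \<in> A" for s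
  proof -
    define B where "B = reply (N (length s)) (\<lambda>\<eta>. tr (f \<eta>) s)"
    have B: "\<forall>\<xi><\<omega> nstar. B \<xi> = \<sigma> (N (length s)) \<xi> (restrict (\<lambda>\<eta>. tr (f \<eta>) s) {..\<xi>})"
      by (simp add: B_def reply_def)
    have legal: "GM_legal1 (\<omega> (N (length s))) (F (N (length s))) (\<lambda>\<eta>. tr (f \<eta>) s) B \<xi>"
      if "\<xi> < \<omega> nstar" for \<xi>
      unfolding B_def by (rule stage_legal1[OF f that s])
    have "unbounded_in (\<omega> (N (length s))) (\<Inter>\<xi>\<in>{..<\<omega> nstar}. B \<xi>)"
      using win[OF s] B legal unfolding GM_winning2_def by blast
    moreover have "B \<xi> \<subseteq> tr (f \<xi>) s" if "\<xi> < \<omega> nstar" for \<xi>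
    proof -
      have "\<forall>\<eta>\<le>\<xi>. GM_legal1 (\<omega> (N (length s))) (F (N (length s))) (\<lambda>\<eta>. tr (f \<eta>) s) B \<eta>"
        using legal that by auto
      then have "GM_legal2 (F (N (length s))) (\<lambda>\<eta>. tr (f \<eta>) s) B \<xi>"
        using win[OF s] B that unfolding GM_winning2_def by blast
      then show ?thesis
        by (simp add: GM_legal2_def)
    qed
    then have "(\<Inter>\<xi>\<in>{..<\<omega> nstar}. B \<xi>) \<subseteq> (\<Inter>\<xi>\<in>{..<\<omega> nstar}. tr (f \<xi>) s)"
      by blast
    ultimately show ?thesis
      by (rule unbounded_in_mono)
  qed
  have pos: "\<omega> 0 < \<omega> nstar"
    using omega_mono nstar_pos by blast

  \<comment> \<open>A branch surviving all stages\<close>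
  define Y where "Y s = (\<Union>\<xi>\<in>{..<\<omega> nstar}. pt (f \<xi>) s)" for s
  have YC: "Y s \<in> C" if "set s \<subseteq> X" for s
    unfolding Y_def
  proof (rule C_chain)
    show "x \<subseteq> y \<or> y \<subseteq> x"
      if xy: "x \<in> (\<lambda>\<xi>. pt (f \<xi>) s) ` {..<\<omega> nstar}" "y \<in> (\<lambda>\<xi>. pt (f \<xi>) s) ` {..<\<omega> nstar}" for x y
    proof -
      obtain \<xi> \<eta> where "x = pt (f \<xi>) s" "\<xi> < \<omega> nstar" "y = pt (f \<eta>) s" "\<eta> < \<omega> nstar"
        using xy by auto
      then show ?thesis
        using pt_mono[of \<xi> \<eta> s] pt_mono[of \<eta> \<xi> s] linear[of \<xi> \<eta>] \<open>set s \<subseteq> X\<close> by auto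
    qed
    show "|(\<lambda>\<xi>. pt (f \<xi>) s) ` {..<\<omega> nstar}| \<le>o |{..<\<omega> nstar}|"
      by (rule card_of_image)
  qed (use ptC that pos in auto)
  \<comment> \<open>Since \<open>Y s\<close> is small, its part below the cardinal of the label is
    bounded, and an entry surviving all stages exists above the bound.\<close>
  have "\<exists>a. a \<in> (\<Inter>\<xi>\<in>{..<\<omega> nstar}. tr (f \<xi>) s) \<and> a < \<omega> (N (length s)) \<and>
      (\<forall>z\<in>Y s. z < \<omega> (N (length s)) \<longrightarrow> z < a)" if "set s \<subseteq> X" "A \<noteq> {}" for s
  proof -
    have n: "N (length s) \<in> A"
      using N_range that by blast
    have "small (Y s \<inter> {..<\<omega> (N (length s))})"
      using C_D[OF YC[OF that(1)]] by (auto intro: small_mono[of _ "Y s"])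
    then obtain \<alpha> where \<alpha>: "\<alpha> < \<omega> (N (length s))"
        "\<forall>z\<in>Y s \<inter> {..<\<omega> (N (length s))}. z < \<alpha>"
      using omega_bounded[OF above[OF n], of "Y s \<inter> {..<\<omega> (N (length s))}"] by auto
    obtain a where "a \<in> (\<Inter>\<xi>\<in>{..<\<omega> nstar}. tr (f \<xi>) s)" "\<alpha> \<le> a"
        "a < \<omega> (N (length s))"
      using unb[OF n] \<alpha>(1) unfolding unbounded_in_def by blast
    then show ?thesis
      using \<alpha>(2) by (intro exI[of _ a]) (auto intro: less_le_trans)
  qed
  then have "\<forall>s. \<exists>a. set s \<subseteq> X \<and> A \<noteq> {} \<longrightarrow> a \<in> (\<Inter>\<xi>\<in>{..<\<omega> nstar}. tr (f \<xi>) s) \<and>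
      a < \<omega> (N (length s)) \<and> (\<forall>z\<in>Y s. z < \<omega> (N (length s)) \<longrightarrow> z < a)"
    by simp
  from choice[OF this] obtain h where "\<forall>s. set s \<subseteq> X \<and> A \<noteq> {} \<longrightarrow> h s \<in> (\<Inter>\<xi>\<in>{..<\<omega> nstar}. tr (f \<xi>) s) \<and>
      h s < \<omega> (N (length s)) \<and> (\<forall>z\<in>Y s. z < \<omega> (N (length s)) \<longrightarrow> z < h s)"
    ..
  then have h: "\<And>s \<xi>. set s \<subseteq> X \<Longrightarrow> A \<noteq> {} \<Longrightarrow> \<xi> < \<omega> nstar \<Longrightarrow> h s \<in> tr (f \<xi>) s"
    "\<And>s. set s \<subseteq> X \<Longrightarrow> A \<noteq> {} \<Longrightarrow> h s < \<omega> (N (length s))"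
    "\<And>s z. set s \<subseteq> X \<Longrightarrow> A \<noteq> {} \<Longrightarrow> z \<in> Y s \<Longrightarrow> z < \<omega> (N (length s)) \<Longrightarrow> z < h s"
    by simp_all
  define b where "b = rec_nat [] (\<lambda>_ s. if A = {} then s else h s # s)"
  have b0: "b 0 = []" and bSuc: "b (Suc k) = (if A = {} then b k else h (b k) # b k)" for k
    by (simp_all add: b_def)
  have len: "length (b k) = (if A = {} then 0 else k)" for k
    by (induction k) (simp_all add: b0 bSuc)
  have bX: "set (b k) \<subseteq> X" for k
  proof (induction k)
    case (Suc k)
    then show ?case
      using h(2)[OF Suc] omega_subset_X by (auto simp: bSuc)
  qed (simp add: b0)
  have btree: "on_tree (tr (f \<xi>)) (b k)" if "\<xi> < \<omega> nstar" for \<xi> k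
    by (induction k) (use h(1)[OF bX] that in \<open>auto simp: b0 bSuc\<close>)
  have pt_b_mono: "pt (f \<xi>) (b j) \<subseteq> pt (f \<xi>) (b k)" if "j \<le> k" "\<xi> < \<omega> nstar" for j k \<xi>
    using that(1)
  proof (induction rule: dec_induct)
    case (step k)
    then show ?case
      using pt_Cons[OF that(2), of "h (b k)" "b k"] bX[of "Suc k"] by (auto simp: bSuc split: if_splits)
  qed simp
  have Y_mono: "Y (b j) \<subseteq> Y (b k)" if "j \<le> k" for j k
    using pt_b_mono[OF that] by (auto simp: Y_def)

  \<comment> \<open>The union of the club sets along the branch\<close>
  define x where "x = (\<Union>k. Y (b k))"
  have "x \<in> C"
    unfolding x_def
  proof (rule C_chain)
    show "u \<subseteq> v \<or> v \<subseteq> u" if uv: "u \<in> range (\<lambda>k. Y (b k))" "v \<in> range (\<lambda>k. Y (b k))" for u v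
    proof -
      obtain j k where "u = Y (b j)" "v = Y (b k)"
        using uv by auto
      then show ?thesis
        using Y_mono[of j k] Y_mono[of k j] linear[of j k] by auto
    qed
    have "|UNIV :: nat set| \<le>o |{..<\<omega> nstar}|"
      using infinite_omega infinite_iff_card_of_nat by blast
    then show "|range (\<lambda>k. Y (b k))| \<le>o |{..<\<omega> nstar}|"
      using card_of_image ordLeq_transitive by blast
  qed (use YC bX in auto)

  \<comment> \<open>Cofinality below \<open>\<omega> n\<close> for \<open>n \<in> A\<close>\<close>
  moreover have "cf (x \<inter> {..<\<omega> n}) = \<omega> 0" if n: "n \<in> A" for n
  proof (rule cf_eqI)
    define H where "H = {h (b k) | k. N k = n}"
    have ne: "A \<noteq> {}"
      using n by blast
    have hx: "h (b k) \<in> x" for k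
    proof -
      have "h (b k) \<in> pt (f (\<omega> 0)) (b (Suc k))"
        using set_pt[OF pos bX[of "Suc k"]] ne by (simp add: bSuc)
      then show ?thesis
        using pos unfolding x_def Y_def by blast
    qed
    show "H \<subseteq> x \<inter> {..<\<omega> n}"
      using hx h(2)[OF bX ne] len ne by (auto simp: H_def)
    \<comment> \<open>One \<open>Y (b k)\<close> catches all of \<open>D\<close>, and a later level
      labelled \<open>n\<close> adds an entry above it. This gives cofinality of \<open>H\<close>,
      its infinitude and the failure of finite sets to be cofinal.\<close>
    have fin: "\<exists>y\<in>H. \<forall>d\<in>D. d < y" if "finite D" "D \<subseteq> x \<inter> {..<\<omega> n}" for D
    proof -
      have "\<exists>k. D \<subseteq> Y (b k)"
        using that
      proof (induction D)
        case (insert d D)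
        then obtain j k where "d \<in> Y (b j)" "D \<subseteq> Y (b k)"
          unfolding x_def by auto
        then have "insert d D \<subseteq> Y (b (max j k))"
          using Y_mono[of j "max j k"] Y_mono[of k "max j k"] by auto
        then show ?case
          by blast
      qed simp
      then obtain k where k: "D \<subseteq> Y (b k)"
        by blast
      obtain i where i: "i \<ge> k" "N i = n"
        using N_surj[OF n] by blast
      have "d < h (b i)" if "d \<in> D" for d
      proof (rule h(3)[OF bX ne])
        show "d \<in> Y (b i)"
          using that k Y_mono[OF i(1)] by blast
        show "d < \<omega> (N (length (b i)))"
          using that \<open>D \<subseteq> x \<inter> {..<\<omega> n}\<close> len ne i(2) by auto
      qed
      then show ?thesis
        using i by (auto simp: H_def)
    qed
    show "\<forall>y\<in>x \<inter> {..<\<omega> n}. \<exists>c\<in>H. y \<le> c"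
    proof
      fix y assume "y \<in> x \<inter> {..<\<omega> n}"
      then show "\<exists>c\<in>H. y \<le> c"
        using fin[of "{y}"] by (auto intro: less_imp_le)
    qed
    have "infinite H"
      using fin[of H] \<open>H \<subseteq> x \<inter> {..<\<omega> n}\<close> by blast
    moreover have "countable H"
      unfolding H_def by (simp add: setcompr_eq_image)
    ultimately have card_H: "|H| =o |UNIV :: nat set|"
      using countable_infiniteE' card_of_ordIso ordIso_symmetric by metis
    have natLeq0: "|{..<\<omega> 0}| =o natLeq"
      using alephs by (simp add: alephs_def)
    show "|H| =o |{..<\<omega> 0}|"
      by (rule ordIso_transitive[OF ordIso_transitive[OF card_H card_of_nat]
            ordIso_symmetric[OF natLeq0]])
    show "\<exists>y\<in>x \<inter> {..<\<omega> n}. \<forall>d\<in>D. d < y" if "D \<subseteq> x \<inter> {..<\<omega> n}" "|D| <o |{..<\<omega> 0}|" for D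
    proof -
      have "finite D"
        by (simp add: finite_iff_ordLess_natLeq ordLess_ordIso_trans[OF that(2) natLeq0])
      then show ?thesis
        using fin[OF _ that(1)] \<open>H \<subseteq> x \<inter> {..<\<omega> n}\<close> by blast
    qed
  qed (rule initial)

  \<comment> \<open>Cofinality below \<open>\<omega> m\<close> for
    \<open>m \<notin> A\<close>\<close>
  moreover have "cf (x \<inter> {..<\<omega> m}) = \<omega> nstar" if m: "nstar < m" "m \<notin> A" for m
  proof (rule cf_eqI)
    define E where "E = {\<xi>. \<xi> < \<omega> nstar \<and> (\<exists>k. good \<xi> k m)}"
    have lower: "z < bnd (f \<xi>)" if "\<eta> \<le> \<xi>" "\<xi> < \<omega> nstar" "good \<xi> (length (b k)) m"
      "z \<in> pt (f \<eta>) (b k)" "z < \<omega> m" for z \<eta> \<xi> k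
      using less_bnd[OF that(2,3) btree[OF that(2)] _ that(5)] pt_mono[OF that(1,2) bX] that(4)
      by blast
    have E_unb: "\<exists>\<xi>\<ge>\<alpha>. \<xi> < \<omega> nstar \<and> good \<xi> (length (b k)) m" if "\<alpha> < \<omega> nstar" for \<alpha> k
      using p_fibres[OF that, of "(length (b k), m)"] m len unfolding good_def by auto
    \<comment> \<open>The branch meets every level that is served, since \<open>good\<close> allows
      only \<open>k = 0\<close> when \<open>A = {}\<close>.\<close>
    have E_len: "\<exists>k. good \<xi> (length (b k)) m" if \<xi>: "\<xi> \<in> E" for \<xi>
    proof -
      obtain k where k: "good \<xi> k m"
        using \<xi> by (auto simp: E_def)
      then have "length (b k) = k"
        using len by (auto simp: good_def)
      then show ?thesis
        using k by (intro exI[of _ k]) simp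
    qed
    \<comment> \<open>The earlier bound belongs to the set at \<open>b k\<close>, hence lies below
      the bound of stage \<open>\<xi>\<close>.\<close>
    have bnd_mono: "bnd (f \<eta>) < bnd (f \<xi>)" if \<eta>\<xi>: "\<eta> \<in> E" "\<xi> \<in> E" "\<eta> < \<xi>" for \<eta> \<xi>
    proof -
      obtain k where k: "good \<xi> (length (b k)) m"
        using E_len \<eta>\<xi>(2) by blast
      have "bnd (f \<eta>) < \<omega> m"
        using bnd_less \<eta>\<xi>(1) by (auto simp: E_def)
      then show ?thesis
        using lower[of \<xi> \<xi> k "bnd (f \<eta>)"] k bnd_pt[OF \<eta>\<xi>(3) _ bX] \<eta>\<xi>(2) by (auto simp: E_def)
    qed
    define Z where "Z = (\<lambda>\<xi>. bnd (f \<xi>)) ` E"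
    have two_bounded: "\<exists>\<theta><\<omega> nstar. \<eta> < \<theta> \<and> \<zeta> < \<theta>" if "\<eta> < \<omega> nstar" "\<zeta> < \<omega> nstar" for \<eta> \<zeta>
    proof -
      have "|{\<eta>, \<zeta>}| \<le>o |{..<\<omega> 0}|"
        using infinite_omega by (intro ordLess_imp_ordLeq finite_ordLess_infinite)
          (simp_all add: Field_card_of card_of_well_order_on)
      then show ?thesis
        using omega_bounded[of 0 nstar "{\<eta>, \<zeta>}"] nstar_pos that by auto
    qed
    have "bnd (f \<eta>) \<in> x" if \<eta>: "\<eta> < \<omega> nstar" for \<eta>
    proof -
      obtain \<xi> where "\<eta> < \<xi>" "\<xi> < \<omega> nstar"
        using two_bounded[OF \<eta> \<eta>] by blast
      then show ?thesis
        using bnd_pt[OF _ _ bX] unfolding x_def Y_def by blast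
    qed
    then show Zx: "Z \<subseteq> x \<inter> {..<\<omega> m}"
      using bnd_less by (auto simp: Z_def E_def)
    \<comment> \<open>The stage is taken beyond \<open>\<eta>\<close> and beyond the stage at which
      \<open>z\<close> appeared, and serves the level of the node where it appeared.\<close>
    have above_E: "\<exists>\<xi>\<in>E. \<eta> < \<xi> \<and> z < bnd (f \<xi>)"
      if z: "z \<in> x" "z < \<omega> m" and \<eta>: "\<eta> < \<omega> nstar" for z \<eta>
    proof -
      obtain k \<zeta> where \<zeta>: "\<zeta> < \<omega> nstar" "z \<in> pt (f \<zeta>) (b k)"
        using z(1) by (auto simp: x_def Y_def)
      obtain \<theta> where \<theta>: "\<theta> < \<omega> nstar" "\<eta> < \<theta>" "\<zeta> < \<theta>"
        using two_bounded[OF \<eta> \<zeta>(1)] by blast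
      then obtain \<xi> where "\<xi> \<ge> \<theta>" "\<xi> < \<omega> nstar" "good \<xi> (length (b k)) m"
        using E_unb by blast
      then show ?thesis
        using lower[of \<zeta> \<xi> k z] \<theta> \<zeta> z by (auto simp: E_def)
    qed
    then show "\<forall>y\<in>x \<inter> {..<\<omega> m}. \<exists>c\<in>Z. y \<le> c"
      using pos unfolding Z_def by (fastforce intro: less_imp_le)
    \<comment> \<open>Bounds above the elements of \<open>D\<close> occur at a set of stages that is
      bounded by regularity of \<open>\<omega> nstar\<close>; a later stage in \<open>E\<close>
      dominates them.\<close>
    show small_bounded: "\<exists>y\<in>x \<inter> {..<\<omega> m}. \<forall>d\<in>D. d < y"
      if D: "D \<subseteq> x \<inter> {..<\<omega> m}" "|D| <o |{..<\<omega> nstar}|" for D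
    proof -
      have "\<exists>\<xi>. \<xi> \<in> E \<and> d < bnd (f \<xi>)" if "d \<in> D" for d
        using above_E[OF _ _ pos, of d] that D(1) by blast
      then obtain g where g: "\<And>d. d \<in> D \<Longrightarrow> g d \<in> E \<and> d < bnd (f (g d))"
        by metis
      obtain j where j: "nstar = Suc j"
        using nstar_pos by (cases nstar) auto
      have "|g ` D| \<le>o |{..<\<omega> j}|"
        using D(2) card_of_image[of g D] ordLeq_transitive unfolding j card_omega_Suc_iff by blast
      moreover have "g ` D \<subseteq> {..<\<omega> nstar}"
        using g by (auto simp: E_def)
      ultimately obtain \<alpha> where \<alpha>: "\<alpha> < \<omega> nstar" "\<forall>z\<in>g ` D. z < \<alpha>"
        using omega_bounded[of j nstar "g ` D"] j by auto
      obtain \<xi> where \<xi>: "\<xi> \<in> E" "\<alpha> \<le> \<xi>"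
        using E_unb[OF \<alpha>(1), of 0] unfolding E_def by blast
      have "d < bnd (f \<xi>)" if "d \<in> D" for d
        using g[OF that] bnd_mono[of "g d" \<xi>] \<alpha>(2) \<xi> that by fastforce
      moreover have "bnd (f \<xi>) \<in> x \<inter> {..<\<omega> m}"
        using \<xi>(1) Zx by (auto simp: Z_def)
      ultimately show ?thesis
        by blast
    qed
    show "|Z| =o |{..<\<omega> nstar}|"
    proof -
      \<comment> \<open>A smaller \<open>Z\<close> would have a strict bound in
        \<open>x \<inter> {..<\<omega> m}\<close>, yet by \<open>above_E\<close> its elements are
        cofinal there.\<close>
      have "\<not> |Z| <o |{..<\<omega> nstar}|"
      proof
        assume "|Z| <o |{..<\<omega> nstar}|"
        then obtain y where "y \<in> x" "y < \<omega> m" "\<forall>d\<in>Z. d < y"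
          using small_bounded[OF Zx] by auto
        then show False
          using above_E[OF _ _ pos, of y] by (force simp: Z_def)
      qed
      moreover have "|Z| \<le>o |E|"
        unfolding Z_def by (rule card_of_image)
      moreover have "|E| \<le>o |{..<\<omega> nstar}|"
        by (rule card_of_mono1) (auto simp: E_def)
      ultimately show ?thesis
        using ordLeq_transitive ordLeq_iff_ordLess_or_ordIso by metis
    qed
  qed (rule initial)
  ultimately show ?thesis
    by blast
qed

end

section \<open>Coding of labels and tasks by natural numbers\<close>

theorem theorem4p1:
  fixes \<omega> :: "nat \<Rightarrow> 'a::wellorder" and A :: "nat set" and nstar :: nat
  assumes "alephs \<omega>"
    and "0 < nstar" and "\<forall>n\<in>A. nstar < n"
    and "\<forall>n\<in>A. \<exists>F. filter_on (\<omega> n) F \<and> complete_filter (\<omega> n) F \<and> contains_cobounded (\<omega> n) F \<and>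
           (\<exists>\<sigma>. GM_winning2 (\<omega> n) (\<omega> nstar) F \<sigma>)"
  shows "stationary (aleph_omega \<omega>) (\<omega> (nstar + 1))
           {x. x \<subseteq> aleph_omega \<omega> \<and> |x| \<le>o |{..<\<omega> nstar}| \<and>
               (\<forall>n\<in>A. cf (x \<inter> {..<\<omega> n}) = \<omega> 0) \<and>
               (\<forall>n. nstar < n \<and> n \<notin> A \<longrightarrow> cf (x \<inter> {..<\<omega> n}) = \<omega> nstar)}"
  unfolding stationary_def
proof (intro conjI allI impI)
  interpret aleph_sequence \<omega>
    by unfold_locales (rule assms(1))
  let ?X = "aleph_omega \<omega>"
  let ?S = "{x. x \<subseteq> ?X \<and> |x| \<le>o |{..<\<omega> nstar}| \<and>
               (\<forall>n\<in>A. cf (x \<inter> {..<\<omega> n}) = \<omega> 0) \<and>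
               (\<forall>n. nstar < n \<and> n \<notin> A \<longrightarrow> cf (x \<inter> {..<\<omega> n}) = \<omega> nstar)}"
  show "?S \<subseteq> small_subsets ?X (\<omega> (nstar + 1))"
    by (auto simp: small_subsets_def card_omega_Suc_iff)
  fix C assume C: "club ?X (\<omega> (nstar + 1)) C"
  obtain F \<sigma> where F: "\<And>n. n \<in> A \<Longrightarrow> complete_filter (\<omega> n) (F n) \<and>
      GM_winning2 (\<omega> n) (\<omega> nstar) (F n) (\<sigma> n)"
    using assms(4) by metis
  obtain N :: "nat \<Rightarrow> nat" where N: "A \<noteq> {} \<Longrightarrow> N i \<in> A" "n \<in> A \<Longrightarrow> \<exists>i\<ge>k. N i = n" for i n k
  proof -
    \<comment> \<open>Each \<open>n \<in> A\<close> appears at the indices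
      \<open>prod_encode (n, k) \<ge> k\<close>; values outside \<open>A\<close> are replaced by a
      fixed element of \<open>A\<close>.\<close>
    define N where "N i = (let n = fst (prod_decode i) in if n \<in> A then n else (SOME n. n \<in> A))" for i
    have "N i \<in> A" if "A \<noteq> {}" for i
      using that by (auto simp: N_def Let_def some_in_eq)
    moreover have "\<exists>i\<ge>k. N i = n" if "n \<in> A" for n k
      using that le_prod_encode_2[of k n] by (intro exI[of _ "prod_encode (n, k)"]) (simp add: N_def)
    ultimately show ?thesis
      by (rule that)
  qed
  obtain q where q: "\<And>k \<alpha>. \<alpha> < \<omega> nstar \<Longrightarrow> \<exists>\<xi>\<ge>\<alpha>. \<xi> < \<omega> nstar \<and> q \<xi> = (k :: nat)"
    using unbounded_fibres[of nstar] by blast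
  define p where "p = (\<lambda>\<xi>. prod_decode (q \<xi>))"
  have p: "\<exists>\<xi>\<ge>\<alpha>. \<xi> < \<omega> nstar \<and> p \<xi> = r" if "\<alpha> < \<omega> nstar" for \<alpha> r
    using q[OF that, of "prod_encode r"] by (auto simp: p_def)
  interpret stationary_game \<omega> A nstar C F \<sigma> N p
    by unfold_locales (use assms(2,3) C F N p in auto)
  obtain x where "x \<in> C" "\<forall>n\<in>A. cf (x \<inter> {..<\<omega> n}) = \<omega> 0"
    "\<forall>n. nstar < n \<and> n \<notin> A \<longrightarrow> cf (x \<inter> {..<\<omega> n}) = \<omega> nstar"
    using exists_cofinalities by blast
  then show "?S \<inter> C \<noteq> {}"
    using C_D by blast
qed

end
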